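(* Let $X$ be a fordable pre-Riesz space and $(Y,i)$ a vector lattice cover of $X$. Let $S\subseteq X$ be a non-empty subset. Then the smallest extension band in $Y$ of the band $\mathcal{B}_S$ of $X$ generated by $S$ is the band $\mathcal{B}_{i(S)}$ of $Y$ generated by $i(S)$.
   Context: All ordered vector spaces are real vector spaces with a partial order given by a cone $X_+$ ($x\le y$ iff $y-x\in X_+$). A linear subspace $D$ of an ordered vector space $Z$ is order dense in $Z$ if for every $z\in Z$ one has $z=\inf\{d\in D: z\le d\}$ (infimum in $Z$). A linear map $i$ is bipositive if $i(x)\ge 0\iff x\ge 0$. An ordered vector space $X$ is pre-Riesz if there are a vector lattice $Y$ and a bipositive linear map $i\colon X\to Y$ with $i(X)$ order dense in $Y$; then $(Y,i)$ is called a vector lattice cover of $X$. For $M\subseteq X$ let $M^u$ be the set of upper bounds of $M$ in $X$. Elements $x,y\in X$ are disjoint, $x\perp y$, if $\{x+y,-(x+y)\}^u=\{x-y,-(x-y)\}^u$ (in a vector lattice this is the usual disjointness). For $M\subseteq X$, $M^{\mathrm d}=\{x\in X: x\perp y\text{ for all }y\in M\}$ and $M^{\mathrm{dd}}=(M^{\mathrm d})^{\mathrm d}$. A band is a linear subspace $B$ with $B=B^{\mathrm{dd}}$ (in $X$ and in $Y$ alike). $\mathcal{B}_M$ denotes the intersection of all bands containing $M$ (the band generated by $M$). A pre-Riesz space $X$ is fordable if for a vector lattice cover $(Y,i)$ (equivalently, for every vector lattice cover) and every $y\in Y_+$ there is a set $T\subseteq X$ with $\{y\}^{\mathrm d}=i(T)^{\mathrm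 d}$ in $Y$. A band $J$ of $Y$ is an extension band of a band $B$ of $X$ if $B=\{x\in X: i(x)\in J\}$. Every band of $X$ has an extension band in $Y$, and the intersection of all its extension bands is the smallest extension band. *)

theory Defs
  imports Complex_Main "HOL-Library.Lattice_Algebras" "HOL-Library.Lub_Glb"
begin

class vector_lattice = ordered_real_vector + lattice
begin

subclass lattice_ab_group_add ..

end

definition order_dense :: "'a::ordered_real_vector set \<Rightarrow> bool" where
  "order_dense D \<longleftrightarrow> subspace D \<and> (\<forall>z. isGlb UNIV {d \<in> D. z \<le> d} z)"

definition bipositive :: "('a::ordered_real_vector \<Rightarrow> 'b::ordered_real_vector) \<Rightarrow> bool" where
  "bipositive i \<longleftrightarrow> (\<forall>x. 0 \<le> i x \<longleftrightarrow> 0 \<le> x)"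

definition vector_lattice_cover :: "('a::ordered_real_vector \<Rightarrow> 'b::vector_lattice) \<Rightarrow> bool" where
  "vector_lattice_cover i \<longleftrightarrow> linear i \<and> bipositive i \<and> order_dense (range i)"

definition disjoint_elems :: "'a::ordered_real_vector \<Rightarrow> 'a \<Rightarrow> bool" where
  "disjoint_elems x y \<longleftrightarrow> ubs UNIV {x + y, - (x + y)} = ubs UNIV {x - y, - (x - y)}"

definition disjoint_complement :: "'a::ordered_real_vector set \<Rightarrow> 'a set" where
  "disjoint_complement M = {x. \<forall>y\<in>M. disjoint_elems x y}"

definition band :: "'a::ordered_real_vector set \<Rightarrow> bool" where
  "band B \<longleftrightarrow> subspace B \<and> B = disjoint_complement (disjoint_complement B)"

definition generated_band :: "'a::ordered_real_vector set \<Rightarrow> 'a set" where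
  "generated_band M = \<Inter>{B. band B \<and> M \<subseteq> B}"

text \<open>
  A space \<open>'a\<close> is pre-Riesz if some vector lattice cover of it exists, and fordable if
  \<open>fordable_via j\<close> holds for some cover \<open>j\<close>. As HOL has no quantification over types inside
  formulas, the existential over the covering vector lattice cannot be a closed definition on \<open>'a\<close>.
  A theorem assumes fordability of \<open>'a\<close> by assuming \<open>fordable_via j\<close> for an
  arbitrary \<open>j :: 'a \<Rightarrow> 'c\<close> with \<open>'c\<close> a type variable of its own.
\<close>

definition fordable_via :: "('a::ordered_real_vector \<Rightarrow> 'c::vector_lattice) \<Rightarrow> bool" where
  "fordable_via j \<longleftrightarrow> vector_lattice_cover j \<and>
     (\<forall>y\<ge>0. \<exists>T. disjoint_complement {y} = disjoint_complement (j ` T))"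

definition extension_band ::
    "('a::ordered_real_vector \<Rightarrow> 'b::vector_lattice) \<Rightarrow> 'a set \<Rightarrow> 'b set \<Rightarrow> bool" where
  "extension_band i B J \<longleftrightarrow> band B \<and> band J \<and> B = {x. i x \<in> J}"

definition smallest_extension_band ::
    "('a::ordered_real_vector \<Rightarrow> 'b::vector_lattice) \<Rightarrow> 'a set \<Rightarrow> 'b set \<Rightarrow> bool" where
  "smallest_extension_band i B J \<longleftrightarrow>
     extension_band i B J \<and> (\<forall>J'. extension_band i B J' \<longrightarrow> J \<subseteq> J')"

lemma smallest_extension_band_eq_Inter:
  "smallest_extension_band i B J \<Longrightarrow> J = \<Inter>{J'. extension_band i B J'}"
  unfolding smallest_extension_band_def by blast

end

theory Submission
  imports Defs
begin

text \<open>
  Write \<open>x \<sqinter> y \<le> 0\<close> when every common lower bound of \<open>x\<close> and \<open>y\<close> is \<open>\<le> 0\<close>. In any ordered vector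
  space \<open>x \<bottom> y\<close> holds iff \<open>\<plusminus>x \<sqinter> \<plusminus>y \<le> 0\<close> for all four choices of signs, and a vector lattice cover
  preserves and reflects the relation \<open>x \<sqinter> y \<le> 0\<close>. Since an element \<open>z\<close> of a cover is the supremum
  of the \<open>i w \<le> z\<close>, disjointness in the cover is determined by this relation on \<open>X\<close>. Hence
  fordability passes from one cover to any other: it only has to be tested on the positive parts
  of elements of \<open>X\<close>.

  Disjoint complements are subspaces, so the band generated by \<open>S\<close> is \<open>S\<^sup>d\<^sup>d\<close>, both in \<open>X\<close> and in
  \<open>Y\<close>, and it remains to see that \<open>i(S)\<^sup>d\<^sup>d\<close> restricts to \<open>S\<^sup>d\<^sup>d\<close>. For the nontrivial inclusion let
  \<open>x \<in> S\<^sup>d\<^sup>d\<close> and \<open>z \<in> i(S)\<^sup>d\<close>, and write \<open>{z}\<^sup>d = i(T)\<^sup>d\<close>. Then \<open>i(S) \<subseteq> i(T)\<^sup>d\<close>, so \<open>T \<subseteq> S\<^sup>d\<close>, so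
  \<open>x \<bottom> T\<close>, and therefore \<open>i x \<bottom> z\<close>.
\<close>

section \<open>Disjointness through common lower bounds\<close>

definition meet_nonpos :: "'a::ordered_real_vector \<Rightarrow> 'a \<Rightarrow> bool" where
  "meet_nonpos x y \<longleftrightarrow> (\<forall>v. v \<le> x \<and> v \<le> y \<longrightarrow> v \<le> 0)"

lemma meet_nonposI: "(\<And>v. v \<le> x \<Longrightarrow> v \<le> y \<Longrightarrow> v \<le> 0) \<Longrightarrow> meet_nonpos x y"
  by (simp add: meet_nonpos_def)

lemma meet_nonposD: "meet_nonpos x y \<Longrightarrow> v \<le> x \<Longrightarrow> v \<le> y \<Longrightarrow> v \<le> 0"
  by (simp add: meet_nonpos_def)

lemma meet_nonpos_commute: "meet_nonpos x y \<longleftrightarrow> meet_nonpos y x"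
  by (auto simp: meet_nonpos_def)

lemma meet_nonpos_nonpos: "x \<le> 0 \<Longrightarrow> meet_nonpos x y"
  by (auto simp: meet_nonpos_def)

lemma meet_nonpos_mono: "meet_nonpos x y \<Longrightarrow> x' \<le> x \<Longrightarrow> y' \<le> y \<Longrightarrow> meet_nonpos x' y'"
  by (meson meet_nonpos_def order_trans)

lemma scaleR_pos_le_zero_iff: "0 < r \<Longrightarrow> r *\<^sub>R v \<le> 0 \<longleftrightarrow> v \<le> (0::'a::ordered_real_vector)"
  using pos_le_divideR_eq[of r v 0] by simp

text \<open>The substitution \<open>z = x + y - 2 *\<^sub>R v\<close> turns common lower bounds
  \<open>v\<close> of \<open>x\<close> and \<open>y\<close> into upper bounds \<open>z\<close> of
  \<open>x - y\<close> and \<open>y - x\<close>, and \<open>v \<le> 0\<close> into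
  \<open>x + y \<le> z\<close>. Changing signs gives the other three conditions.\<close>

lemma disjoint_elems_iff_meet_nonpos:
  fixes x y :: "'a::ordered_real_vector"
  shows "disjoint_elems x y \<longleftrightarrow>
    meet_nonpos x y \<and> meet_nonpos x (- y) \<and> meet_nonpos (- x) y \<and> meet_nonpos (- x) (- y)"
proof -
  have ubs_eq: "disjoint_elems x y \<longleftrightarrow>
      (\<forall>z. x + y \<le> z \<and> - (x + y) \<le> z \<longleftrightarrow> x - y \<le> z \<and> - (x - y) \<le> z)" for x y :: 'a
    by (auto simp: disjoint_elems_def ubs_def isUb_def setle_def set_eq_iff)
  have sum_le: "x + y \<le> z" if P: "meet_nonpos x y" and z: "x - y \<le> z" "- (x - y) \<le> z" for x y z :: 'a
  proof -
    have "x + y - z \<le> 2 *\<^sub>R x" "x + y - z \<le> 2 *\<^sub>R y"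
      using z by (simp_all add: scaleR_2 algebra_simps)
    then have "(1/2) *\<^sub>R (x + y - z) \<le> x" "(1/2) *\<^sub>R (x + y - z) \<le> y"
      using scaleR_left_mono[of "x + y - z" _ "1/2"] by force+
    with P have "(1/2) *\<^sub>R (x + y - z) \<le> 0" by (rule meet_nonposD)
    then show ?thesis by (simp add: scaleR_pos_le_zero_iff)
  qed
  have meet: "meet_nonpos x y"
    if ub: "\<And>z. x - y \<le> z \<Longrightarrow> y - x \<le> z \<Longrightarrow> x + y \<le> z" for x y :: 'a
  proof (rule meet_nonposI)
    fix v assume "v \<le> x" "v \<le> y"
    then have "x + y \<le> x + y - 2 *\<^sub>R v"
      by (intro ub) (simp_all add: scaleR_2 algebra_simps add_mono)
    then show "v \<le> 0" by (simp add: scaleR_pos_le_zero_iff)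
  qed
  have minus_right: "disjoint_elems x (- y) \<longleftrightarrow> disjoint_elems x y" for x y :: 'a
    unfolding disjoint_elems_def diff_minus_eq_add add_uminus_conv_diff by (rule eq_commute)
  have minus_left: "disjoint_elems (- x) y \<longleftrightarrow> disjoint_elems x y" for x y :: 'a
  proof -
    have eq: "- x + y = - (x - y)" "- x - y = - (x + y)" by simp_all
    show ?thesis
      unfolding disjoint_elems_def eq minus_minus insert_commute[of "- _"] by (rule eq_commute)
  qed
  show ?thesis (is "_ \<longleftrightarrow> ?R")
  proof
    assume "disjoint_elems x y"
    moreover have "meet_nonpos x y" if "disjoint_elems x y" for x y :: 'a
      using that unfolding ubs_eq minus_diff_eq by (intro meet) blast
    ultimately show ?R by (metis minus_left minus_right)
  next
    assume ?R
    then show "disjoint_elems x y"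
      unfolding ubs_eq
      using sum_le[of x y] sum_le[of x "- y"] sum_le[of "- x" y] sum_le[of "- x" "- y"]
      by (intro allI iffI conjI) (simp_all add: add.commute)
  qed
qed

lemma disjoint_elems_sym: "disjoint_elems x y \<longleftrightarrow> disjoint_elems y x"
  unfolding disjoint_elems_iff_meet_nonpos
  by (metis meet_nonpos_commute)

lemma disjoint_elems_minus: "disjoint_elems (- x) y \<longleftrightarrow> disjoint_elems x y"
  by (auto simp: disjoint_elems_iff_meet_nonpos)

section \<open>Disjoint complements in vector lattices\<close>

lemma meet_nonpos_sup_zero:
  fixes x y :: "'a::vector_lattice"
  assumes "meet_nonpos x y"
  shows "meet_nonpos (sup x 0) y"
proof (rule meet_nonposI)
  fix v assume v: "v \<le> sup x 0" "v \<le> y"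
  have "inf v x \<le> 0"
    using v by (auto intro: meet_nonposD[OF assms] le_infI1)
  then have "v + x \<le> sup v x"
    using add_right_mono[of "inf v x" 0 "sup v x"] add_eq_inf_sup[of v x] by (simp add: add.commute)
  also have "\<dots> \<le> sup x 0" using v by simp
  finally have "v \<le> sup x 0 - x" by (simp add: algebra_simps)
  \<comment> \<open>The positive part \<open>sup x 0\<close> and the negative part
    \<open>sup x 0 - x\<close> of \<open>x\<close> have infimum 0, and \<open>v\<close> lies below
    both.\<close>
  moreover have "inf (sup x 0) (sup x 0 - x) = sup x 0 + inf 0 (- x)"
    by (simp add: add_inf_distrib_left)
  moreover have "inf 0 (- x) = - sup x 0"
    by (simp add: inf_commute)
  ultimately show "v \<le> 0" using v by (metis le_infI add.right_inverse)
qed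

lemma meet_nonpos_sup_zero_iff:
  fixes x y :: "'a::vector_lattice"
  shows "meet_nonpos (sup x 0) y \<longleftrightarrow> meet_nonpos x y"
  by (meson meet_nonpos_sup_zero meet_nonpos_mono order_refl sup_ge1)

text \<open>Subtracting the positive part of \<open>y\<close> from a lower bound of
  \<open>x + y\<close> and \<open>m\<close> leaves a common lower bound of \<open>x\<close> and
  \<open>m\<close>.\<close>

lemma meet_nonpos_add:
  fixes x y m :: "'a::vector_lattice"
  assumes "meet_nonpos x m" "meet_nonpos y m"
  shows "meet_nonpos (x + y) m"
proof (rule meet_nonposI)
  fix v assume v: "v \<le> x + y" "v \<le> m"
  have "v - sup y 0 \<le> x"
    unfolding diff_le_eq using v(1) add_left_mono[OF sup_ge1[of y 0], of x] by (rule order_trans)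
  moreover have "v - sup y 0 \<le> m"
    unfolding diff_le_eq using v(2) add_mono[of v m 0 "sup y 0"] by simp
  ultimately have "v \<le> sup y 0"
    using meet_nonposD[OF assms(1), of "v - sup y 0"] by (simp only: diff_le_0_iff_le)
  then show "v \<le> 0"
    using meet_nonposD[OF meet_nonpos_sup_zero[OF assms(2)]] v(2) by blast
qed

text \<open>Natural multiples are repeated sums, and some natural number bounds \<open>r\<close>.
  Passing to the positive part of \<open>x\<close> makes the multiples monotone in the
  scalar.\<close>

lemma meet_nonpos_scaleR:
  fixes x m :: "'a::vector_lattice"
  assumes "meet_nonpos x m" "0 \<le> r"
  shows "meet_nonpos (r *\<^sub>R x) m"
proof -
  obtain n :: nat where n: "r \<le> real n" using real_arch_simple by blast
  have "meet_nonpos (real k *\<^sub>R sup x 0) m" for k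
    by (induction k)
      (simp_all add: meet_nonpos_nonpos meet_nonpos_add meet_nonpos_sup_zero assms(1) scaleR_left_distrib)
  moreover have "r *\<^sub>R x \<le> real n *\<^sub>R sup x 0"
    using n assms(2) by (intro order_trans[OF scaleR_left_mono scaleR_right_mono]) auto
  ultimately show ?thesis by (meson meet_nonpos_mono order_refl)
qed

lemma subspace_disjoint_complement_lattice:
  "subspace (disjoint_complement (M :: 'a::vector_lattice set))"
proof (rule subspaceI)
  show "0 \<in> disjoint_complement M"
    by (simp add: disjoint_complement_def disjoint_elems_iff_meet_nonpos meet_nonpos_nonpos)
next
  fix x y assume "x \<in> disjoint_complement M" "y \<in> disjoint_complement M"
  then show "x + y \<in> disjoint_complement M"
    using meet_nonpos_add[of "- x" _ "- y"]
    by (auto simp: disjoint_complement_def disjoint_elems_iff_meet_nonpos meet_nonpos_add)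
next
  fix r :: real and x assume x: "x \<in> disjoint_complement M"
  have nonneg: "s *\<^sub>R x \<in> disjoint_complement M" if "0 \<le> s" for s
    using x that meet_nonpos_scaleR[of "- x" _ s]
    by (auto simp: disjoint_complement_def disjoint_elems_iff_meet_nonpos meet_nonpos_scaleR)
  show "r *\<^sub>R x \<in> disjoint_complement M"
    using nonneg[of r] nonneg[of "- r"] disjoint_elems_minus[of "r *\<^sub>R x"]
    by (cases "0 \<le> r") (auto simp: disjoint_complement_def)
qed

section \<open>Generated bands as double complements\<close>

lemma subset_disjoint_complement_twice: "M \<subseteq> disjoint_complement (disjoint_complement M)"
  using disjoint_elems_sym by (fastforce simp: disjoint_complement_def)

lemma disjoint_complement_antimono: "M \<subseteq> N \<Longrightarrow> disjoint_complement N \<subseteq> disjoint_complement M"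
  by (auto simp: disjoint_complement_def)

text \<open>Complements are assumed to be subspaces so that one lemma serves both the lattice and
  the covered space, where this is proved by different means.\<close>

lemma band_double_complement:
  fixes M :: "'a::ordered_real_vector set"
  assumes "\<And>N :: 'a set. subspace (disjoint_complement N)"
  shows "band (disjoint_complement (disjoint_complement M))"
  unfolding band_def
  using assms subset_disjoint_complement_twice disjoint_complement_antimono
  by (metis subset_antisym)

lemma generated_band_eq_double_complement:
  fixes M :: "'a::ordered_real_vector set"
  assumes "\<And>N :: 'a set. subspace (disjoint_complement N)"
  shows "generated_band M = disjoint_complement (disjoint_complement M)"
proof
  show "generated_band M \<subseteq> disjoint_complement (disjoint_complement M)"
    using band_double_complement[OF assms] subset_disjoint_complement_twice
    unfolding generated_band_def by blast
  show "disjoint_complement (disjoint_complement M) \<subseteq> generated_band M"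
    unfolding generated_band_def
  proof (rule Inter_greatest)
    fix B assume "B \<in> {B. band B \<and> M \<subseteq> B}"
    then have "B = disjoint_complement (disjoint_complement B)" "M \<subseteq> B"
      by (simp_all add: band_def)
    then show "disjoint_complement (disjoint_complement M) \<subseteq> B"
      using disjoint_complement_antimono by metis
  qed
qed

section \<open>Transfer along a vector lattice cover\<close>

context
  fixes i :: "'a::ordered_real_vector \<Rightarrow> 'b::vector_lattice"
  assumes cover: "vector_lattice_cover i"
begin

lemma cover_linear: "linear i"
  using cover by (simp add: vector_lattice_cover_def)

lemma cover_le_iff: "i x \<le> i y \<longleftrightarrow> x \<le> y"
proof -
  have "0 \<le> i (y - x) \<longleftrightarrow> 0 \<le> y - x"
    using cover by (simp add: vector_lattice_cover_def bipositive_def)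
  then show ?thesis by (simp add: linear_diff[OF cover_linear])
qed

lemma cover_le_zero_iff: "i x \<le> 0 \<longleftrightarrow> x \<le> 0"
  using cover_le_iff[of x 0] linear_0[OF cover_linear] by simp

lemma cover_minus: "i (- x) = - i x"
  by (rule linear_neg[OF cover_linear])

text \<open>Order density speaks of infima; applied to \<open>- z\<close> it makes \<open>z\<close>
  the supremum of the \<open>i w\<close> below it.\<close>

lemma cover_le_if_below:
  assumes "\<And>w. i w \<le> z \<Longrightarrow> i w \<le> u"
  shows "z \<le> u"
proof -
  have "isGlb UNIV {d \<in> range i. - z \<le> d} (- z)"
    using cover by (simp add: vector_lattice_cover_def order_dense_def)
  moreover have "- u \<le> d" if "d \<in> range i" "- z \<le> d" for d
    using that assms by (metis cover_minus imageE minus_le_iff)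
  ultimately have "- u \<le> - z"
    unfolding isGlb_def greatestP_def isLb_def setge_def setle_def by blast
  then show ?thesis by simp
qed

text \<open>It suffices to bound the \<open>i w\<close> below a common lower bound, and such a
  \<open>w\<close> is a common lower bound of itself and \<open>x\<close>.\<close>

lemma meet_nonpos_cover_right:
  "meet_nonpos z (i x) \<longleftrightarrow> (\<forall>w. i w \<le> z \<longrightarrow> meet_nonpos w x)"
proof
  assume "meet_nonpos z (i x)"
  then show "\<forall>w. i w \<le> z \<longrightarrow> meet_nonpos w x"
    unfolding meet_nonpos_def by (metis cover_le_iff cover_le_zero_iff order_trans)
next
  assume *: "\<forall>w. i w \<le> z \<longrightarrow> meet_nonpos w x"
  show "meet_nonpos z (i x)"
  proof (rule meet_nonposI, rule cover_le_if_below)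
    fix v w assume "v \<le> z" "v \<le> i x" "i w \<le> v"
    then have "i w \<le> z" "w \<le> x" using cover_le_iff by (metis order_trans)+
    then show "i w \<le> 0" using * cover_le_zero_iff meet_nonposD by blast
  qed
qed

lemma meet_nonpos_below:
  "meet_nonpos z y \<longleftrightarrow> (\<forall>x. i x \<le> y \<longrightarrow> meet_nonpos z (i x))"
proof
  assume "meet_nonpos z y"
  then show "\<forall>x. i x \<le> y \<longrightarrow> meet_nonpos z (i x)"
    using meet_nonpos_mono by blast
next
  assume *: "\<forall>x. i x \<le> y \<longrightarrow> meet_nonpos z (i x)"
  show "meet_nonpos z y"
  proof (rule meet_nonposI, rule cover_le_if_below)
    fix v w assume "v \<le> z" "v \<le> y" "i w \<le> v"
    then have "i w \<le> z" "i w \<le> y" by auto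
    then show "i w \<le> 0" using * meet_nonposD by blast
  qed
qed

lemma meet_nonpos_cover: "meet_nonpos (i x) (i y) \<longleftrightarrow> meet_nonpos x y"
  unfolding meet_nonpos_cover_right cover_le_iff
  using meet_nonpos_mono by blast

lemma disjoint_elems_cover: "disjoint_elems (i x) (i y) \<longleftrightarrow> disjoint_elems x y"
  by (simp add: disjoint_elems_iff_meet_nonpos meet_nonpos_cover flip: cover_minus)

lemma disjoint_complement_cover:
  "disjoint_complement M = i -` disjoint_complement (i ` M)"
  by (auto simp: disjoint_complement_def disjoint_elems_cover)

text \<open>A complement in \<open>'a\<close> is the preimage of one in the lattice under the linear
  map \<open>i\<close>.\<close>

lemma subspace_disjoint_complement: "subspace (disjoint_complement (M :: 'a set))"
  unfolding disjoint_complement_cover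
  by (rule linear_subspace_vimage[OF cover_linear subspace_disjoint_complement_lattice])

end

section \<open>Fordability and change of cover\<close>

text \<open>
  The condition obtained here refers to the order of \<open>X\<close> alone, so it is independent of the cover.
\<close>

lemma fordable_via_meet_nonpos:
  fixes j :: "'a::ordered_real_vector \<Rightarrow> 'c::vector_lattice"
  assumes "fordable_via j"
  shows "\<exists>T. \<forall>w::'a. meet_nonpos w x \<longleftrightarrow> (\<forall>t\<in>T. meet_nonpos w t \<and> meet_nonpos w (- t))"
proof -
  have cover: "vector_lattice_cover j"
    using assms by (simp add: fordable_via_def)
  have disjoint_pos: "disjoint_elems (sup a 0) b \<longleftrightarrow> meet_nonpos a b \<and> meet_nonpos a (- b)"
    for a b :: 'c
    by (auto simp: disjoint_elems_iff_meet_nonpos meet_nonpos_sup_zero_iff intro: meet_nonpos_nonpos)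
  obtain T where T: "disjoint_complement {sup (j x) 0} = disjoint_complement (j ` T)"
    using assms unfolding fordable_via_def by (meson sup_ge2)
  have "meet_nonpos w x \<longleftrightarrow> (\<forall>t\<in>T. meet_nonpos w t \<and> meet_nonpos w (- t))" for w
  proof -
    have "meet_nonpos w x \<longleftrightarrow> meet_nonpos (j w) (sup (j x) 0)"
      by (metis meet_nonpos_commute meet_nonpos_cover[OF cover] meet_nonpos_sup_zero_iff)
    also have "\<dots> \<longleftrightarrow> disjoint_elems (sup (j w) 0) (sup (j x) 0)"
      unfolding disjoint_pos
      by (metis meet_nonpos_commute meet_nonpos_nonpos neg_le_0_iff_le sup_ge2)
    also have "\<dots> \<longleftrightarrow> (\<forall>t\<in>T. disjoint_elems (sup (j w) 0) (j t))"
      using T by (auto simp: disjoint_complement_def set_eq_iff)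
    finally show ?thesis
      by (simp add: disjoint_pos meet_nonpos_cover[OF cover] flip: cover_minus[OF cover])
  qed
  then show ?thesis by blast
qed

lemma fordable_disjoint_complement:
  fixes i :: "'a::ordered_real_vector \<Rightarrow> 'b::vector_lattice"
    and j :: "'a \<Rightarrow> 'c::vector_lattice"
  assumes fordable: "fordable_via j" and cover: "vector_lattice_cover i"
  obtains T where "disjoint_complement {y} = disjoint_complement (i ` T)"
proof -
  have "\<forall>x::'a. \<exists>T. \<forall>w. meet_nonpos w x \<longleftrightarrow> (\<forall>t\<in>T. meet_nonpos w t \<and> meet_nonpos w (- t))"
    by (intro allI fordable_via_meet_nonpos[OF fordable])
  from choice[OF this] obtain T where
    T: "\<forall>(x::'a) w. meet_nonpos w x \<longleftrightarrow> (\<forall>t\<in>T x. meet_nonpos w t \<and> meet_nonpos w (- t))" ..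
  have T_cover: "meet_nonpos z (i x) \<longleftrightarrow> (\<forall>t\<in>T x. meet_nonpos z (i t) \<and> meet_nonpos z (- i t))" for x z
    unfolding cover_minus[OF cover, symmetric] meet_nonpos_cover_right[OF cover]
    using T[rule_format, of _ x] by blast
  \<comment> \<open>\<open>y\<close> is the supremum of the \<open>i x\<close> below it, so the test
    sets \<open>T x\<close> of all these \<open>x\<close> together test
    \<open>meet_nonpos z y\<close>.\<close>
  define U :: "'b \<Rightarrow> 'a set" where "U y = (\<Union>x\<in>{x. i x \<le> y}. T x)" for y
  have U: "meet_nonpos z y \<longleftrightarrow> (\<forall>t\<in>U y. meet_nonpos z (i t) \<and> meet_nonpos z (- i t))" for y z
  proof -
    have "meet_nonpos z y \<longleftrightarrow>
        (\<forall>x. i x \<le> y \<longrightarrow> (\<forall>t\<in>T x. meet_nonpos z (i t) \<and> meet_nonpos z (- i t)))"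
      by (simp only: meet_nonpos_below[OF cover, of z y] T_cover[of z, symmetric])
    then show ?thesis by (auto simp: U_def)
  qed
  \<comment> \<open>\<open>U y\<close> accounts for the two conditions involving \<open>y\<close>,
    and \<open>U (- y)\<close> for the two involving \<open>- y\<close>.\<close>
  have "disjoint_elems z y \<longleftrightarrow> (\<forall>t\<in>U y \<union> U (- y). disjoint_elems z (i t))" for z
    unfolding disjoint_elems_iff_meet_nonpos U[of _ y] U[of _ "- y"] by blast
  then have "disjoint_complement {y} = disjoint_complement (i ` (U y \<union> U (- y)))"
    by (simp add: disjoint_complement_def)
  then show thesis by (rule that)
qed

lemma double_complement_cover:
  fixes i :: "'a::ordered_real_vector \<Rightarrow> 'b::vector_lattice"
    and j :: "'a \<Rightarrow> 'c::vector_lattice"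
  assumes fordable: "fordable_via j" and cover: "vector_lattice_cover i"
  shows "disjoint_complement (disjoint_complement S) =
    {x. i x \<in> disjoint_complement (disjoint_complement (i ` S))}"
proof (intro set_eqI iffI CollectI)
  fix x assume x: "x \<in> disjoint_complement (disjoint_complement S)"
  have "disjoint_elems (i x) z" if z: "z \<in> disjoint_complement (i ` S)" for z
  proof -
    obtain T where T: "disjoint_complement {z} = disjoint_complement (i ` T)"
      using fordable_disjoint_complement[OF assms] .
    have "i ` S \<subseteq> disjoint_complement {z}"
      using z disjoint_elems_sym by (fastforce simp: disjoint_complement_def)
    then have "T \<subseteq> disjoint_complement S"
      unfolding T using disjoint_elems_sym
      by (fastforce simp: disjoint_complement_def disjoint_elems_cover[OF cover])
    then have "i x \<in> disjoint_complement (i ` T)"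
      using x by (auto simp: disjoint_complement_def disjoint_elems_cover[OF cover])
    then show ?thesis unfolding T[symmetric] by (simp add: disjoint_complement_def)
  qed
  then show "i x \<in> disjoint_complement (disjoint_complement (i ` S))"
    by (simp add: disjoint_complement_def[of "disjoint_complement _"])
next
  fix x assume "x \<in> {x. i x \<in> disjoint_complement (disjoint_complement (i ` S))}"
  then show "x \<in> disjoint_complement (disjoint_complement S)"
    \<comment> \<open>Elements of the complement of \<open>S\<close> are mapped by \<open>i\<close>
      into the complement of the image of \<open>S\<close>.\<close>
    by (simp add: disjoint_complement_def) (metis disjoint_elems_cover[OF cover])
qed

theorem theorem18:
  fixes i :: "'a::ordered_real_vector \<Rightarrow> 'b::vector_lattice"
    and j :: "'a \<Rightarrow> 'c::vector_lattice"
    and S :: "'a set"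
  assumes fordable: "fordable_via j"
    and cover: "vector_lattice_cover i"
    and nonempty: "S \<noteq> {}"
  shows "smallest_extension_band i (generated_band S) (generated_band (i ` S))"
proof -
  note sub = subspace_disjoint_complement[OF cover]
  note gen = generated_band_eq_double_complement[OF sub]
    generated_band_eq_double_complement[OF subspace_disjoint_complement_lattice]
  have "extension_band i (generated_band S) (generated_band (i ` S))"
    unfolding extension_band_def gen
    by (intro conjI band_double_complement sub subspace_disjoint_complement_lattice
        double_complement_cover[OF fordable cover])
  \<comment> \<open>\<open>J\<close> is a band whose preimage contains \<open>S\<close>, so it
    contains the image of \<open>S\<close>.\<close>
  moreover have "generated_band (i ` S) \<subseteq> J" if "extension_band i (generated_band S) J" for J
    using that unfolding extension_band_def generated_band_def by blast
  ultimately show ?thesis by (simp add: smallest_extension_band_def)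
qed

end
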